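(* Let $(X,W_d)$ be a $d$-dimensional simplicial network ($d\ge 1$), let $\sigma\in C_d(X)$ be a current generator (i.e. the current generator $\sigma$ is a $d$-simplex of $X$), let $i_\sigma\in\mathbb{R}\setminus\{0\}$, and let $I\in C_d(X)$, $V\in C^d(X)$ and $v_\sigma\in\mathbb{R}$ be the associated current on $X$, voltage on $X$ and voltage component at $\sigma$ (as defined in the context). Let $\phi\in C^{d-1}(X)$ be a potential for $V$, i.e. $\delta^X_{d-1}\phi=V$. Then $$\mathcal{R}_d(\sigma,\sigma)=-\frac{v_\sigma}{i_\sigma}.$$ Equivalently, $r_\sigma=r'_\sigma$, where $r_\sigma=\mathcal{R}_d(\sigma,\sigma)$ is the effective resistance of the chain $\sigma$ and $r'_\sigma=-v_\sigma/i_\sigma$ is the Kook–Lee effective resistance of the current generator $\sigma$.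
   Context: A simplicial network $(X,W_d)$ is a finite $d$-dimensional simplicial complex $X$ (on $n$ ordered vertices $\{1,\dots,n\}$) with positive weights $w(\tau)$ on its $d$-simplices, gathered in the diagonal matrix $W_d$; all lower-dimensional simplices have weight $1$. $C_p(X)$ is the real vector space on the oriented $p$-simplices with inner product $\langle\tau,\tau'\rangle_{C_p}=w(\tau)^{-1}$ if $\tau=\tau'$ and $0$ otherwise; $\partial^X_p$ is the boundary map and $*$ denotes adjoints. $C^p(X)$ is the dual space, $\delta^X_p$ is the dual of $\partial^X_{p+1}$ ($\delta^X_p\phi=\phi\circ\partial^X_{p+1}$), and $\flat^X_p:C_p(X)\to C^p(X)$ is $\flat^X_p(\alpha)=\langle\alpha,\cdot\rangle_{C_p}$. Effective resistance bilinear form: $\mathcal{R}_d(\alpha,\alpha')=\langle(\partial^X_d)^{*}(\mathcal{L}^{\mathrm{up}}_{d-1})^{+}\partial^X_d\alpha,\alpha'\rangle_{C_d}$, with $\mathcal{L}^{\mathrm{up}}_{d-1}=\partial^X_d(\partial^X_d)^{*}$ and $^{+}$ the Moore–Penrose pseudoinverse with respect to the given inner products. Current generator: a subset $\sigma\subset\{1,\dots,n\}$ with $|\sigma|=d+1$ such that $\partial_d\sigma=-\partial^X_d(c)$ for some $c\in C_d(X)$, where $\partial_d\sigma$ is the usual simplicial boundary of the oriented simplex $\sigma$. Extended complex $Z$: $\ker\partial^X_d\xrightarrow{\partial^Z_{d+1}}C_d(X\sqcup\{\sigma\})\xrightarrow{\partial^Z_d}C_{d-1}(X)\to\cdots$,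 where $C_d(X\sqcup\{\sigma\})=C_d(X)\oplus\mathrm{span}(\sigma)$ (a new formal copy of $\sigma$ is adjoined, even if $\sigma$ is already a simplex of $X$), $\partial^Z_{d+1}$ is the inclusion of $\ker\partial^X_d$ (with inner product induced from $C_d(X)$) into the summand $C_d(X)$, $\partial^Z_d|_{C_d(X)}=\partial^X_d$ and $\partial^Z_d(\sigma)=\partial_d\sigma=-\partial^X_d(c)$. The inner product on $C_d(X\sqcup\{\sigma\})$ extends that of $C_d(X)$ with the new element $\sigma$ orthogonal to $C_d(X)$ and of norm $1$. Current: given $i_\sigma\neq0$, $I_\sigma=I+i_\sigma\sigma$ with $I\in C_d(X)$ is the unique element of $\ker\partial^Z_d\cap\ker(\partial^Z_{d+1})^{*}$ (a one-dimensional space) whose component on the new $\sigma$ is $i_\sigma$. Voltage: $V=\flat^X_dI$, and $V_\sigma=V+v_\sigma\sigma^\vee\in C^d(X\sqcup\{\sigma\})$, where $V$ is extended by zero on the new $\sigma$, $\sigma^\vee$ is the functional equal to $1$ on the new $\sigma$ and $0$ on $C_d(X)$, and $v_\sigma\in\mathbb{R}$ is determined by $V_\sigma(I_\sigma)=0$, i.e. $\langle I,I\rangle_{C_d(X)}+i_\sigma v_\sigma=0$. *)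

theory Defs
  imports "HOL-Analysis.Analysis" "HOL-Analysis.Finite_Function_Topology"
begin

section \<open>Subspaces with an explicit inner product\<close>

text \<open>The inner products below depend on the weights of a network, so they are carried along
  with the underlying subspace instead of being a type class instance.\<close>

record 'a ip_space =
  vecs :: "'a set"
  ip :: "'a \<Rightarrow> 'a \<Rightarrow> real"

definition linear_between ::
  "'a::real_vector set \<Rightarrow> 'b::real_vector set \<Rightarrow> ('a \<Rightarrow> 'b) \<Rightarrow> bool" where
  "linear_between S T f \<longleftrightarrow> f \<in> S \<rightarrow> T \<and>
     (\<forall>x\<in>S. \<forall>y\<in>S. f (x + y) = f x + f y) \<and> (\<forall>r. \<forall>x\<in>S. f (r *\<^sub>R x) = r *\<^sub>R f x)"

definition kernel_on :: "'a ip_space \<Rightarrow> ('a \<Rightarrow> 'b::zero) \<Rightarrow> 'a set" where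
  "kernel_on V f = {x \<in> vecs V. f x = 0}"

text \<open>Maps between carriers are made canonical by being \<open>undefined\<close> outside the carrier.\<close>

definition adjoint_on :: "'a ip_space \<Rightarrow> 'b ip_space \<Rightarrow> ('a \<Rightarrow> 'b) \<Rightarrow> 'b \<Rightarrow> 'a" where
  "adjoint_on V W f = restrict (\<lambda>y. THE x. x \<in> vecs V \<and> (\<forall>a\<in>vecs V. ip W (f a) y = ip V a x)) (vecs W)"

definition pinv_on ::
  "'a::real_vector ip_space \<Rightarrow> 'b::real_vector ip_space \<Rightarrow> ('a \<Rightarrow> 'b) \<Rightarrow> 'b \<Rightarrow> 'a" where
  "pinv_on V W f = (THE g. g \<in> extensional (vecs W) \<and> linear_between (vecs W) (vecs V) g \<and>
     (\<forall>x\<in>vecs V. f (g (f x)) = f x) \<and>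
     (\<forall>y\<in>vecs W. g (f (g y)) = g y) \<and>
     (\<forall>y\<in>vecs W. \<forall>z\<in>vecs W. ip W (f (g y)) z = ip W y (f (g z))) \<and>
     (\<forall>x\<in>vecs V. \<forall>z\<in>vecs V. ip V (g (f x)) z = ip V x (g (f z))))"

definition dual_on :: "'a::real_vector ip_space \<Rightarrow> ('a \<Rightarrow> real) set" where
  "dual_on V = {\<phi> \<in> extensional (vecs V). linear_between (vecs V) UNIV \<phi>}"

definition flat_on :: "'a ip_space \<Rightarrow> 'a \<Rightarrow> 'a \<Rightarrow> real" where
  "flat_on V \<alpha> = restrict (ip V \<alpha>) (vecs V)"


section \<open>Simplicial networks\<close>

text \<open>A simplex is its nonempty vertex set. It stands for the oriented simplex whose orientation is
  given by the increasing order of its vertices.\<close>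

definition simplicial_network :: "nat \<Rightarrow> nat \<Rightarrow> nat set set \<Rightarrow> (nat set \<Rightarrow> real) \<Rightarrow> bool" where
  "simplicial_network n d X w \<longleftrightarrow>
     (\<forall>\<tau>\<in>X. \<tau> \<noteq> {} \<and> \<tau> \<subseteq> {1..n}) \<and>
     (\<forall>v\<in>{1..n}. {v} \<in> X) \<and>
     (\<forall>\<tau>\<in>X. \<forall>\<rho>. \<rho> \<subseteq> \<tau> \<and> \<rho> \<noteq> {} \<longrightarrow> \<rho> \<in> X) \<and>
     (\<forall>\<tau>\<in>X. card \<tau> \<le> d + 1) \<and> (\<exists>\<tau>\<in>X. card \<tau> = d + 1) \<and>
     (\<forall>\<tau>\<in>X. card \<tau> = d + 1 \<longrightarrow> w \<tau> > 0)"

definition simplices :: "nat set set \<Rightarrow> nat \<Rightarrow> nat set set" where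
  "simplices X p = {\<tau> \<in> X. card \<tau> = p + 1}"

type_synonym chain = "(nat set, real) poly_mapping"

text \<open>\<open>C\<^sub>p(X)\<close>; only the values of \<open>w\<close> on \<open>d\<close>-simplices matter, simplices of other dimensions have
  weight 1.\<close>

definition chain_space :: "nat \<Rightarrow> nat set set \<Rightarrow> (nat set \<Rightarrow> real) \<Rightarrow> nat \<Rightarrow> chain ip_space" where
  "chain_space d X w p = \<lparr>vecs = {\<alpha>. Poly_Mapping.keys \<alpha> \<subseteq> simplices X p},
     ip = (\<lambda>\<alpha> \<beta>. \<Sum>\<tau>\<in>simplices X p.
       Poly_Mapping.lookup \<alpha> \<tau> * Poly_Mapping.lookup \<beta> \<tau> / (if p = d then w \<tau> else 1))\<rparr>"

abbreviation simplex_chain :: "nat set \<Rightarrow> chain" where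
  "simplex_chain \<tau> \<equiv> Poly_Mapping.single \<tau> 1"

text \<open>The vertex \<open>v\<close> has position \<open>card {u \<in> \<tau>. u < v}\<close> (counted from 0) in the ordered simplex \<open>\<tau>\<close>.\<close>

definition simplex_boundary :: "nat set \<Rightarrow> chain" where
  "simplex_boundary \<tau> = (\<Sum>v\<in>\<tau>. (- 1) ^ card {u \<in> \<tau>. u < v} *\<^sub>R simplex_chain (\<tau> - {v}))"

text \<open>Linear extension to all chains. Its restriction to \<open>C\<^sub>p(X)\<close> is \<open>\<partial>\<^sub>p\<close> for \<open>p \<ge> 1\<close>; it is not used
  in degree 0, where it would be the augmentation.\<close>

definition boundary :: "chain \<Rightarrow> chain" where
  "boundary \<alpha> = (\<Sum>\<tau>\<in>Poly_Mapping.keys \<alpha>. Poly_Mapping.lookup \<alpha> \<tau> *\<^sub>R simplex_boundary \<tau>)"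

definition coboundary ::
  "nat \<Rightarrow> nat set set \<Rightarrow> (nat set \<Rightarrow> real) \<Rightarrow> nat \<Rightarrow> (chain \<Rightarrow> real) \<Rightarrow> chain \<Rightarrow> real" where
  "coboundary d X w p \<phi> = restrict (\<phi> \<circ> boundary) (vecs (chain_space d X w (p + 1)))"

definition boundary_adjoint :: "nat \<Rightarrow> nat set set \<Rightarrow> (nat set \<Rightarrow> real) \<Rightarrow> chain \<Rightarrow> chain" where
  "boundary_adjoint d X w = adjoint_on (chain_space d X w d) (chain_space d X w (d - 1)) boundary"

definition up_laplacian :: "nat \<Rightarrow> nat set set \<Rightarrow> (nat set \<Rightarrow> real) \<Rightarrow> chain \<Rightarrow> chain" where
  "up_laplacian d X w = boundary \<circ> boundary_adjoint d X w"

definition eff_resistance ::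
  "nat \<Rightarrow> nat set set \<Rightarrow> (nat set \<Rightarrow> real) \<Rightarrow> chain \<Rightarrow> chain \<Rightarrow> real" where
  "eff_resistance d X w \<alpha> \<alpha>' =
     ip (chain_space d X w d)
       (boundary_adjoint d X w
         (pinv_on (chain_space d X w (d - 1)) (chain_space d X w (d - 1)) (up_laplacian d X w) (boundary \<alpha>)))
       \<alpha>'"


section \<open>Current generators, currents and voltages\<close>

definition current_generator ::
  "nat \<Rightarrow> nat \<Rightarrow> nat set set \<Rightarrow> (nat set \<Rightarrow> real) \<Rightarrow> nat set \<Rightarrow> bool" where
  "current_generator n d X w \<sigma> \<longleftrightarrow> \<sigma> \<subseteq> {1..n} \<and> card \<sigma> = d + 1 \<and>
     (\<exists>c\<in>vecs (chain_space d X w d). simplex_boundary \<sigma> = - boundary c)"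

text \<open>\<open>C\<^sub>d(X \<squnion> {\<sigma>})\<close>, the pair \<open>(\<alpha>, t)\<close> standing for \<open>\<alpha> + t \<sigma>\<close> with the new copy of \<open>\<sigma>\<close>.\<close>

definition ext_chains ::
  "nat \<Rightarrow> nat set set \<Rightarrow> (nat set \<Rightarrow> real) \<Rightarrow> (chain \<times> real) ip_space" where
  "ext_chains d X w = \<lparr>vecs = vecs (chain_space d X w d) \<times> UNIV,
     ip = (\<lambda>(\<alpha>, s) (\<beta>, t). ip (chain_space d X w d) \<alpha> \<beta> + s * t)\<rparr>"

definition cycles :: "nat \<Rightarrow> nat set set \<Rightarrow> (nat set \<Rightarrow> real) \<Rightarrow> chain ip_space" where
  "cycles d X w = \<lparr>vecs = kernel_on (chain_space d X w d) boundary, ip = ip (chain_space d X w d)\<rparr>"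

definition ext_boundary :: "nat set \<Rightarrow> chain \<times> real \<Rightarrow> chain" where
  "ext_boundary \<sigma> = (\<lambda>(\<alpha>, t). boundary \<alpha> + t *\<^sub>R simplex_boundary \<sigma>)"

definition ext_inclusion :: "chain \<Rightarrow> chain \<times> real" where
  "ext_inclusion \<alpha> = (\<alpha>, 0)"

definition is_current ::
  "nat \<Rightarrow> nat set set \<Rightarrow> (nat set \<Rightarrow> real) \<Rightarrow> nat set \<Rightarrow> real \<Rightarrow> chain \<Rightarrow> bool" where
  "is_current d X w \<sigma> i I \<longleftrightarrow> I \<in> vecs (chain_space d X w d) \<and>
     (I, i) \<in> kernel_on (ext_chains d X w) (ext_boundary \<sigma>) \<inter>
       kernel_on (ext_chains d X w) (adjoint_on (cycles d X w) (ext_chains d X w) ext_inclusion)"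

text \<open>\<open>V + v \<sigma>\<^sup>\<or>\<close>\<close>

definition ext_voltage ::
  "nat \<Rightarrow> nat set set \<Rightarrow> (nat set \<Rightarrow> real) \<Rightarrow> (chain \<Rightarrow> real) \<Rightarrow> real \<Rightarrow> chain \<times> real \<Rightarrow> real" where
  "ext_voltage d X w V v = restrict (\<lambda>(\<alpha>, t). V \<alpha> + v * t) (vecs (ext_chains d X w))"

end

theory Submission
  imports Defs
begin

text \<open>Both sides are the energy \<open>\<langle>I, I\<rangle> / i\<^sub>\<sigma>\<^sup>2\<close> of the current that flows through \<open>X\<close> when \<open>\<sigma>\<close>
  generates a unit current. For the right-hand side this is the relation
  \<open>\<langle>I, I\<rangle> + i\<^sub>\<sigma> v\<^sub>\<sigma> = 0\<close> that determines \<open>v\<^sub>\<sigma>\<close>.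

  For the left-hand side, write \<open>\<phi> = \<langle>\<cdot>, y\<rangle>\<close> with a chain \<open>y\<close> (\<open>riesz\<close>). Ohm's law
  \<open>\<delta>\<phi> = V = \<flat>I\<close> then says \<open>I = \<partial>\<^sup>* y\<close>, and Kirchhoff's law \<open>\<partial>I + i\<^sub>\<sigma> \<partial>\<sigma> = 0\<close> gives
  \<open>\<partial>\<sigma> = \<partial>\<partial>\<^sup>* u\<close> with \<open>u = -y / i\<^sub>\<sigma>\<close>. For \<open>L = \<partial>\<partial>\<^sup>*\<close> the chain \<open>L\<^sup>+ L u\<close> differs from \<open>u\<close> by an
  element of \<open>ker L = ker \<partial>\<^sup>*\<close>, so \<open>\<partial>\<^sup>* L\<^sup>+ \<partial>\<sigma> = \<partial>\<^sup>* u\<close> (\<open>adjoint_pinv_gram\<close>), and pairing with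
  \<open>\<sigma>\<close> yields \<open>\<langle>\<partial>\<^sup>* u, \<sigma>\<rangle> = \<langle>u, \<partial>\<sigma>\<rangle> = \<langle>u, \<partial>\<partial>\<^sup>* u\<rangle> = \<langle>\<partial>\<^sup>* u, \<partial>\<^sup>* u\<rangle>\<close>
  (\<open>pinv_gram_energy\<close>), where \<open>\<partial>\<^sup>* u = -I / i\<^sub>\<sigma>\<close>.

  The adjoint and the pseudoinverse are given by definite descriptions, so most of the work is to
  show that they exist and are unique. This is linear algebra on a carrier with its own inner
  product: Gram--Schmidt gives orthogonal projections, these represent functionals and hence yield
  adjoints, and minimum-norm least-squares solutions form the Moore--Penrose inverse.\<close>

section \<open>Finite-dimensional inner product spaces on a carrier\<close>

locale fin_ip_space =
  fixes S :: "'a::real_vector ip_space"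
  assumes subspace_vecs: "subspace (vecs S)"
    and finite_span: "\<exists>B. finite B \<and> vecs S \<subseteq> span B"
    and ip_add_left:
      "\<lbrakk>x \<in> vecs S; y \<in> vecs S; z \<in> vecs S\<rbrakk> \<Longrightarrow> ip S (x + y) z = ip S x z + ip S y z"
    and ip_scaleR_left: "\<lbrakk>x \<in> vecs S; z \<in> vecs S\<rbrakk> \<Longrightarrow> ip S (r *\<^sub>R x) z = r * ip S x z"
    and ip_commute: "\<lbrakk>x \<in> vecs S; y \<in> vecs S\<rbrakk> \<Longrightarrow> ip S x y = ip S y x"
    and ip_pos: "\<lbrakk>x \<in> vecs S; x \<noteq> 0\<rbrakk> \<Longrightarrow> ip S x x > 0"
begin

lemma closed [simp, intro]:
  "0 \<in> vecs S"
  "\<lbrakk>x \<in> vecs S; y \<in> vecs S\<rbrakk> \<Longrightarrow> x + y \<in> vecs S"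
  "\<lbrakk>x \<in> vecs S; y \<in> vecs S\<rbrakk> \<Longrightarrow> x - y \<in> vecs S"
  "x \<in> vecs S \<Longrightarrow> r *\<^sub>R x \<in> vecs S"
  using subspace_vecs by (auto intro: subspace_0 subspace_add subspace_diff subspace_scale)

lemma ip_diff_left:
  assumes "x \<in> vecs S" "y \<in> vecs S" "z \<in> vecs S"
  shows "ip S (x - y) z = ip S x z - ip S y z"
  using ip_add_left[of "x - y" y z] assms by simp

lemma ip_zero_left: "z \<in> vecs S \<Longrightarrow> ip S 0 z = 0"
  using ip_scaleR_left[of 0 z 0] by simp

lemma ip_add_right:
  "\<lbrakk>x \<in> vecs S; y \<in> vecs S; z \<in> vecs S\<rbrakk> \<Longrightarrow> ip S z (x + y) = ip S z x + ip S z y"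
  by (metis ip_add_left ip_commute closed(2))

lemma ip_diff_right:
  "\<lbrakk>x \<in> vecs S; y \<in> vecs S; z \<in> vecs S\<rbrakk> \<Longrightarrow> ip S z (x - y) = ip S z x - ip S z y"
  by (metis ip_diff_left ip_commute closed(3))

lemma ip_scaleR_right: "\<lbrakk>x \<in> vecs S; z \<in> vecs S\<rbrakk> \<Longrightarrow> ip S z (r *\<^sub>R x) = r * ip S z x"
  by (metis ip_scaleR_left ip_commute closed(4))

lemma ip_zero_right: "z \<in> vecs S \<Longrightarrow> ip S z 0 = 0"
  by (metis ip_zero_left ip_commute closed(1))

lemma ip_eq_zero_iff: "x \<in> vecs S \<Longrightarrow> ip S x x = 0 \<longleftrightarrow> x = 0"
  using ip_pos[of x] ip_zero_left[of x] by force

lemma ip_eqI: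
  assumes "x \<in> vecs S" "y \<in> vecs S" "\<And>a. a \<in> vecs S \<Longrightarrow> ip S a x = ip S a y"
  shows "x = y"
proof -
  have "ip S (x - y) (x - y) = 0"
    using assms by (simp add: ip_diff_right)
  then show ?thesis
    using assms by (simp add: ip_eq_zero_iff)
qed

text \<open>Gram--Schmidt: adjoining a vector \<open>b\<close> to the span adds to the projection the component
  along the part of \<open>b\<close> orthogonal to what was spanned before.\<close>

lemma projection_span:
  assumes "finite B" "B \<subseteq> vecs S" "x \<in> vecs S"
  shows "\<exists>p\<in>span B. \<forall>s\<in>span B. ip S (x - p) s = 0"
  using assms
proof (induction B arbitrary: x rule: finite_induct)
  case empty
  then show ?case by (simp add: ip_zero_right)
next
  case (insert b B)
  have sub: "span (insert b B) \<subseteq> vecs S"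
    using insert.prems subspace_vecs by (simp add: span_minimal)
  then have subB: "span B \<subseteq> vecs S"
    by (meson span_mono subset_insertI subset_trans)
  have spanB: "u \<in> span (insert b B)" if "u \<in> span B" for u
    using that span_mono[of B "insert b B"] by blast
  obtain q where q: "q \<in> span B" "\<And>s. s \<in> span B \<Longrightarrow> ip S (b - q) s = 0"
    using insert.IH[of b] insert.prems by auto
  obtain p where p: "p \<in> span B" "\<And>s. s \<in> span B \<Longrightarrow> ip S (x - p) s = 0"
    using insert.IH[of x] insert.prems by auto
  define e where "e = b - q"
  (* if e = 0, the division by zero yields the coefficient 0, which is right too *)
  define c where "c = ip S (x - p) e / ip S e e"
  have e_in: "e \<in> span (insert b B)"
    unfolding e_def using spanB[OF q(1)] by (intro span_diff) (auto intro: span_base)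
  have V: "e \<in> vecs S" "p \<in> vecs S" "q \<in> vecs S" "x \<in> vecs S"
    using e_in sub subB p q insert.prems by auto
  have ce: "ip S (x - p) e = c * ip S e e"
    using V by (cases "e = 0") (simp_all add: c_def ip_zero_right ip_eq_zero_iff)
  show ?case
  proof (intro bexI ballI)
    show "p + c *\<^sub>R e \<in> span (insert b B)"
      using e_in p spanB by (intro span_add span_scale) auto
    fix s assume "s \<in> span (insert b B)"
    then obtain k where k: "s - k *\<^sub>R b \<in> span B"
      by (auto simp: span_breakdown_eq)
    define t where "t = s - k *\<^sub>R b + k *\<^sub>R q"
    have t: "t \<in> span B"
      unfolding t_def using k q by (intro span_add span_scale) auto
    have s: "s = t + k *\<^sub>R e"
      by (simp add: t_def e_def algebra_simps)
    have "t \<in> vecs S"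
      using t subB by auto
    moreover have "ip S (x - p) t = 0" "ip S e t = 0"
      using p q t by (auto simp: e_def)
    ultimately have "ip S (x - p - c *\<^sub>R e) t = 0" "ip S (x - p - c *\<^sub>R e) e = 0"
      using V ce by (simp_all add: ip_diff_left[of "x - p"] ip_scaleR_left)
    then have "ip S (x - p - c *\<^sub>R e) s = 0"
      using V \<open>t \<in> vecs S\<close> unfolding s by (simp add: ip_add_right ip_scaleR_right)
    then show "ip S (x - (p + c *\<^sub>R e)) s = 0"
      by (simp add: diff_diff_eq)
  qed
qed

lemma projection_exists:
  assumes "subspace U" "U \<subseteq> vecs S" "x \<in> vecs S"
  shows "\<exists>p\<in>U. \<forall>u\<in>U. ip S (x - p) u = 0"
proof -
  obtain B where B: "B \<subseteq> U" "independent B" "U \<subseteq> span B"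
    using real_vector.maximal_independent_subset by blast
  obtain T where T: "finite T" "vecs S \<subseteq> span T"
    using finite_span by blast
  have "finite B"
    using real_vector.independent_span_bound[OF T(1) B(2)] B(1) assms(2) T(2) by auto
  then have "\<exists>p\<in>span B. \<forall>s\<in>span B. ip S (x - p) s = 0"
    using projection_span[of B x] B(1) assms by simp
  moreover have "span B = U"
    using B assms(1) by (simp add: span_minimal subset_antisym)
  ultimately show ?thesis
    by simp
qed

text \<open>A nonzero functional is represented by a multiple of a vector orthogonal to its kernel.\<close>

lemma riesz:
  assumes \<psi>: "linear_between (vecs S) UNIV (\<psi> :: 'a \<Rightarrow> real)"
  shows "\<exists>y\<in>vecs S. \<forall>a\<in>vecs S. \<psi> a = ip S a y"
proof (cases "\<forall>a\<in>vecs S. \<psi> a = 0")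
  case True
  then show ?thesis
    by (intro bexI[of _ 0]) (simp_all add: ip_zero_right)
next
  case False
  then obtain b where b: "b \<in> vecs S" "\<psi> b \<noteq> 0"
    by blast
  have add: "\<psi> (x + y) = \<psi> x + \<psi> y" if "x \<in> vecs S" "y \<in> vecs S" for x y
    using \<psi> that by (simp add: linear_between_def)
  have scale: "\<psi> (r *\<^sub>R x) = r * \<psi> x" if "x \<in> vecs S" for x r
    using \<psi> that by (simp add: linear_between_def)
  have diff: "\<psi> (x - y) = \<psi> x - \<psi> y" if "x \<in> vecs S" "y \<in> vecs S" for x y
    using add[of "x - y" y] that by simp
  have "subspace {a \<in> vecs S. \<psi> a = 0}"
    using scale[of 0 0] by (auto simp: real_vector.subspace_def add scale)
  moreover have "{a \<in> vecs S. \<psi> a = 0} \<subseteq> vecs S"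
    by blast
  ultimately have "\<exists>p\<in>{a \<in> vecs S. \<psi> a = 0}. \<forall>u\<in>{a \<in> vecs S. \<psi> a = 0}. ip S (b - p) u = 0"
    using b(1) by (rule projection_exists)
  then obtain p where p: "p \<in> vecs S" "\<psi> p = 0"
    and p_orth: "\<And>u. \<lbrakk>u \<in> vecs S; \<psi> u = 0\<rbrakk> \<Longrightarrow> ip S (b - p) u = 0"
    by blast
  define z where "z = b - p"
  have z: "z \<in> vecs S" "\<psi> z \<noteq> 0"
    using b p by (simp_all add: z_def diff)
  have z_orth: "ip S z u = 0" if "u \<in> vecs S" "\<psi> u = 0" for u
    unfolding z_def using that by (rule p_orth)
  from z have "z \<noteq> 0"
    using scale[of 0 0] by auto
  then have zz: "ip S z z \<noteq> 0"
    using z by (simp add: ip_eq_zero_iff)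
  have "\<psi> a = ip S a ((\<psi> z / ip S z z) *\<^sub>R z)" if a: "a \<in> vecs S" for a
  proof -
    have "\<psi> (a - (\<psi> a / \<psi> z) *\<^sub>R z) = 0"
      using a z diff scale by simp
    then have "ip S z (a - (\<psi> a / \<psi> z) *\<^sub>R z) = 0"
      using a z by (intro z_orth closed)
    then have za: "ip S z a = \<psi> a / \<psi> z * ip S z z"
      using a z ip_diff_right[of a "(\<psi> a / \<psi> z) *\<^sub>R z" z] ip_scaleR_right[of z z] by simp
    have "\<psi> z / ip S z z * ip S z a = \<psi> a"
      unfolding za using z(2) zz by (simp add: divide_simps)
    moreover have "ip S a ((\<psi> z / ip S z z) *\<^sub>R z) = \<psi> z / ip S z z * ip S z a"
      using ip_scaleR_right[OF z(1) a] ip_commute[OF z(1) a] by metis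
    ultimately show ?thesis
      by metis
  qed
  then show ?thesis
    using closed(4)[OF z(1)] by blast
qed

end

section \<open>Adjoint and Moore--Penrose inverse of a linear map\<close>

locale fin_ip_map = V: fin_ip_space V + W: fin_ip_space W
  for V :: "'a::real_vector ip_space" and W :: "'b::real_vector ip_space" +
  fixes f :: "'a \<Rightarrow> 'b"
  assumes linear_f: "linear_between (vecs V) (vecs W) f"
begin

lemma f_in [simp, intro]: "x \<in> vecs V \<Longrightarrow> f x \<in> vecs W"
  using linear_f by (auto simp: linear_between_def)

lemma f_add: "\<lbrakk>x \<in> vecs V; y \<in> vecs V\<rbrakk> \<Longrightarrow> f (x + y) = f x + f y"
  using linear_f by (simp add: linear_between_def)

lemma f_scaleR: "x \<in> vecs V \<Longrightarrow> f (r *\<^sub>R x) = r *\<^sub>R f x"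
  using linear_f by (simp add: linear_between_def)

lemma f_diff: "\<lbrakk>x \<in> vecs V; y \<in> vecs V\<rbrakk> \<Longrightarrow> f (x - y) = f x - f y"
  using f_add[of "x - y" y] by simp

lemma f_zero: "f 0 = 0"
  using f_scaleR[of 0 0] by simp

lemma image_subset: "f ` vecs V \<subseteq> vecs W"
  by auto

lemma subspace_image: "subspace (f ` vecs V)"
proof (rule subspaceI)
  show "0 \<in> f ` vecs V"
    by (rule image_eqI[of _ _ 0]) (simp_all add: f_zero)
  show "x + y \<in> f ` vecs V" if "x \<in> f ` vecs V" "y \<in> f ` vecs V" for x y
    using that by (auto simp flip: f_add)
  show "r *\<^sub>R x \<in> f ` vecs V" if "x \<in> f ` vecs V" for r x
    using that by (auto simp flip: f_scaleR)
qed

lemma subspace_kernel: "subspace {x \<in> vecs V. f x = 0}"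
  unfolding real_vector.subspace_def by (auto simp: f_zero f_add f_scaleR)

abbreviation "adj \<equiv> adjoint_on V W f"

lemma adjoint:
  assumes y: "y \<in> vecs W"
  shows adjoint_in: "adj y \<in> vecs V"
    and adjoint_ip: "\<And>a. a \<in> vecs V \<Longrightarrow> ip W (f a) y = ip V a (adj y)"
proof -
  have "linear_between (vecs V) UNIV (\<lambda>a. ip W (f a) y)"
    using y by (simp add: linear_between_def f_add f_scaleR W.ip_add_left W.ip_scaleR_left)
  then have "\<exists>x\<in>vecs V. \<forall>a\<in>vecs V. ip W (f a) y = ip V a x"
    by (rule V.riesz)
  then have "\<exists>!x. x \<in> vecs V \<and> (\<forall>a\<in>vecs V. ip W (f a) y = ip V a x)"
    using V.ip_eqI by (metis (no_types, lifting))
  from theI'[OF this] y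
  show "adj y \<in> vecs V" "\<And>a. a \<in> vecs V \<Longrightarrow> ip W (f a) y = ip V a (adj y)"
    by (auto simp: adjoint_on_def)
qed

lemma adjoint_unique:
  assumes "y \<in> vecs W" "x \<in> vecs V" "\<And>a. a \<in> vecs V \<Longrightarrow> ip W (f a) y = ip V a x"
  shows "adj y = x"
  using assms by (intro V.ip_eqI) (simp_all add: adjoint_in flip: adjoint_ip)

lemma linear_adjoint: "linear_between (vecs W) (vecs V) adj"
  unfolding linear_between_def
proof (intro conjI ballI allI)
  show "adj \<in> vecs W \<rightarrow> vecs V"
    using adjoint_in by blast
  show "adj (y + z) = adj y + adj z" if "y \<in> vecs W" "z \<in> vecs W" for y z
    using that
    by (intro adjoint_unique) (simp_all add: W.ip_add_right V.ip_add_right adjoint_in adjoint_ip)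
  show "adj (r *\<^sub>R y) = r *\<^sub>R adj y" if "y \<in> vecs W" for r y
    using that
    by (intro adjoint_unique) (simp_all add: W.ip_scaleR_right V.ip_scaleR_right adjoint_in adjoint_ip)
qed

text \<open>The normal-equation form of being the shortest among the \<open>x\<close> that minimise the distance from
  \<open>f x\<close> to \<open>y\<close>. Being linear in the pair \<open>(x, y)\<close>, it makes linearity of the solution map a
  consequence of uniqueness.\<close>

definition least_squares :: "'b \<Rightarrow> 'a \<Rightarrow> bool" where
  "least_squares y x \<longleftrightarrow> x \<in> vecs V \<and> (\<forall>k\<in>vecs V. f k = 0 \<longrightarrow> ip V x k = 0) \<and>
     (\<forall>u\<in>vecs V. ip W (y - f x) (f u) = 0)"

text \<open>Project \<open>y\<close> to the image of \<open>f\<close>, and remove from a preimage its component in the kernel.\<close>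

lemma least_squares_exists:
  assumes y: "y \<in> vecs W"
  shows "\<exists>x. least_squares y x"
proof -
  obtain z where z: "z \<in> vecs V" "\<And>u. u \<in> vecs V \<Longrightarrow> ip W (y - f z) (f u) = 0"
    using W.projection_exists[OF subspace_image image_subset y] by auto
  obtain q where q: "q \<in> vecs V" "f q = 0"
    "\<And>k. \<lbrakk>k \<in> vecs V; f k = 0\<rbrakk> \<Longrightarrow> ip V (z - q) k = 0"
    using V.projection_exists[OF subspace_kernel _ z(1)] by auto
  have "least_squares y (z - q)"
    using q z by (simp add: least_squares_def f_diff)
  then show ?thesis ..
qed

lemma least_squares_unique:
  assumes y: "y \<in> vecs W" and "least_squares y x" "least_squares y x'"
  shows "x = x'"
proof -
  have x: "x \<in> vecs V" "x' \<in> vecs V"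
    using assms by (auto simp: least_squares_def)
  have "ip W (f (x - x')) (f u) = 0" if "u \<in> vecs V" for u
  proof -
    have "f (x - x') = (y - f x') - (y - f x)"
      using x by (simp add: f_diff)
    then show ?thesis
      using assms x that by (simp add: least_squares_def W.ip_diff_left)
  qed
  then have "f (x - x') = 0"
    using x W.ip_eq_zero_iff[of "f (x - x')"] by simp
  moreover have "ip V (x - x') k = 0" if "k \<in> vecs V" "f k = 0" for k
    using assms x that by (simp add: least_squares_def V.ip_diff_left)
  ultimately have "x - x' = 0"
    using x V.ip_eq_zero_iff by blast
  then show ?thesis by simp
qed

definition penrose :: "('b \<Rightarrow> 'a) \<Rightarrow> bool" where
  "penrose g \<longleftrightarrow> g \<in> extensional (vecs W) \<and> linear_between (vecs W) (vecs V) g \<and>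
     (\<forall>x\<in>vecs V. f (g (f x)) = f x) \<and>
     (\<forall>y\<in>vecs W. g (f (g y)) = g y) \<and>
     (\<forall>y\<in>vecs W. \<forall>z\<in>vecs W. ip W (f (g y)) z = ip W y (f (g z))) \<and>
     (\<forall>x\<in>vecs V. \<forall>z\<in>vecs V. ip V (g (f x)) z = ip V x (g (f z)))"

text \<open>The witness sends \<open>y\<close> to its minimum-norm least-squares solution. Penrose's equations
  then come from uniqueness and two facts: \<open>y - f (g y)\<close> is orthogonal to the image of \<open>f\<close>, and \<open>g y\<close> is orthogonal
  to the kernel of \<open>f\<close>.\<close>

lemma penrose_exists: "\<exists>g. penrose g"
proof -
  define g where "g = restrict (\<lambda>y. SOME x. least_squares y x) (vecs W)"
  have g: "least_squares y (g y)" if "y \<in> vecs W" for y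
    using someI_ex[OF least_squares_exists[OF that]] that by (simp add: g_def)
  have gI: "g y = x" if "least_squares y x" "y \<in> vecs W" for x y
    using least_squares_unique g that by blast
  have gin: "g y \<in> vecs V" if "y \<in> vecs W" for y
    using g[OF that] by (simp add: least_squares_def)
  have res: "ip W (y - f (g y)) (f u) = 0" if "y \<in> vecs W" "u \<in> vecs V" for y u
    using g[OF that(1)] that by (simp add: least_squares_def)
  have orth: "ip V (g y) k = 0" if "y \<in> vecs W" "k \<in> vecs V" "f k = 0" for y k
    using g[OF that(1)] that by (simp add: least_squares_def)
  have add: "g (x + y) = g x + g y" if "x \<in> vecs W" "y \<in> vecs W" for x y
  proof (rule gI)
    have eq: "x + y - f (g x + g y) = (x - f (g x)) + (y - f (g y))"
      using that gin by (simp add: f_add)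
    show "least_squares (x + y) (g x + g y)"
      unfolding least_squares_def eq using that gin res orth by (simp add: V.ip_add_left W.ip_add_left)
  qed (use that in auto)
  have scale: "g (r *\<^sub>R y) = r *\<^sub>R g y" if "y \<in> vecs W" for r y
  proof (rule gI)
    have eq: "r *\<^sub>R y - f (r *\<^sub>R g y) = r *\<^sub>R (y - f (g y))"
      using that gin by (simp add: f_scaleR scaleR_diff_right)
    show "least_squares (r *\<^sub>R y) (r *\<^sub>R g y)"
      unfolding least_squares_def eq using that gin res orth by (simp add: V.ip_scaleR_left W.ip_scaleR_left)
  qed (use that in auto)
  have fgf: "f (g (f x)) = f x" if "x \<in> vecs V" for x
  proof -
    have "f x - f (g (f x)) = f (x - g (f x))"
      using that gin by (simp add: f_diff)
    then have "ip W (f x - f (g (f x))) (f x - f (g (f x))) = 0"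
      using res[of "f x" "x - g (f x)"] that gin by simp
    then show ?thesis
      using that gin W.ip_eq_zero_iff[of "f x - f (g (f x))"] by simp
  qed
  have gfg: "g (f (g y)) = g y" if "y \<in> vecs W" for y
    using that gin orth by (intro gI) (auto simp: least_squares_def W.ip_zero_left)
  (* both products are <f (g y), f (g z)>, as y - f (g y) is orthogonal to the image *)
  have sym_fg: "ip W (f (g y)) z = ip W y (f (g z))" if "y \<in> vecs W" "z \<in> vecs W" for y z
    using res[of y "g z"] res[of z "g y"] that gin
    by (simp add: W.ip_diff_left W.ip_commute[of z] W.ip_commute[of "f (g z)"])
  (* both products are <g (f x), g (f z)>, as x - g (f x) lies in the kernel *)
  have sym_gf: "ip V (g (f x)) z = ip V x (g (f z))" if "x \<in> vecs V" "z \<in> vecs V" for x z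
    using orth[of "f x" "z - g (f z)"] orth[of "f z" "x - g (f x)"] that gin
    by (simp add: V.ip_diff_right f_diff fgf V.ip_commute)
  have "penrose g"
    unfolding penrose_def linear_between_def
    using gin add scale fgf gfg sym_fg sym_gf by (auto simp: g_def)
  then show ?thesis by blast
qed

lemma penroseD:
  assumes "penrose g"
  shows "y \<in> vecs W \<Longrightarrow> g y \<in> vecs V"
    and "x \<in> vecs V \<Longrightarrow> f (g (f x)) = f x"
    and "y \<in> vecs W \<Longrightarrow> g (f (g y)) = g y"
    and "\<lbrakk>y \<in> vecs W; z \<in> vecs W\<rbrakk> \<Longrightarrow> ip W (f (g y)) z = ip W y (f (g z))"
    and "\<lbrakk>x \<in> vecs V; x' \<in> vecs V\<rbrakk> \<Longrightarrow> ip V (g (f x)) x' = ip V x (g (f x'))"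
  using assms by (auto simp: penrose_def linear_between_def)

text \<open>The products \<open>f g\<close> and \<open>g f\<close> of a Moore--Penrose inverse are orthogonal projections, hence
  do not depend on \<open>g\<close>; and \<open>g = g f g\<close> is recovered from them.\<close>

lemma penrose_unique:
  assumes "penrose g" "penrose h"
  shows "g = h"
proof -
  note g = penroseD[OF assms(1)] and h = penroseD[OF assms(2)]
  have fg: "f (g y) = f (h y)" if y: "y \<in> vecs W" for y
  proof (rule W.ip_eqI)
    fix a assume a: "a \<in> vecs W"
    have "ip W a (f (g y)) = ip W (f (h (f (g a)))) y"
      using a y by (simp add: g(1,4) h(2))
    also have "\<dots> = ip W (f (g a)) (f (h y))"
      using a y by (simp add: g(1) h(4))
    also have "\<dots> = ip W a (f (g (f (h y))))"
      using a y by (simp add: g(4) h(1))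
    also have "\<dots> = ip W a (f (h y))"
      using y by (simp add: g(2) h(1))
    finally show "ip W a (f (g y)) = ip W a (f (h y))" .
  qed (use y g(1) h(1) in auto)
  have gf: "g (f x) = h (f x)" if x: "x \<in> vecs V" for x
  proof (rule V.ip_eqI)
    fix a assume a: "a \<in> vecs V"
    have "ip V a (g (f x)) = ip V a (g (f (h (f x))))"
      using x by (simp add: h(2))
    also have "\<dots> = ip V (g (f a)) (h (f x))"
      using a x by (simp add: g(5) h(1))
    also have "\<dots> = ip V (h (f (g (f a)))) x"
      using a x by (simp add: g(1) h(5))
    also have "\<dots> = ip V a (h (f x))"
      using a x by (simp add: g(2) h(5))
    finally show "ip V a (g (f x)) = ip V a (h (f x))" .
  qed (use x g(1) h(1) in auto)
  show ?thesis
  proof (rule extensionalityI[of _ "vecs W"])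
    fix y assume y: "y \<in> vecs W"
    have "g y = g (f (g y))"
      using assms y by (simp add: penrose_def)
    also have "\<dots> = h (f (h y))"
      using y g(1) h(1) by (simp add: gf fg)
    also have "\<dots> = h y"
      using assms y by (simp add: penrose_def)
    finally show "g y = h y" .
  qed (use assms in \<open>auto simp: penrose_def\<close>)
qed

lemma penrose_pinv: "penrose (pinv_on V W f)"
proof -
  have "\<exists>!g. penrose g"
    using penrose_exists penrose_unique by blast
  from theI'[OF this] show ?thesis
    unfolding pinv_on_def penrose_def .
qed

lemma pinv_in: "y \<in> vecs W \<Longrightarrow> pinv_on V W f y \<in> vecs V"
  using penrose_pinv by (auto simp: penrose_def linear_between_def)

lemma f_pinv_f: "x \<in> vecs V \<Longrightarrow> f (pinv_on V W f (f x)) = f x"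
  using penrose_pinv by (simp add: penrose_def)

lemma gram_map: "fin_ip_map W W (f \<circ> adj)"
  using linear_adjoint adjoint_in
  by unfold_locales (auto simp: linear_between_def f_add f_scaleR)

text \<open>\<open>z = (f f\<^sup>*)\<^sup>+ f f\<^sup>* y - y\<close> lies in the kernel of \<open>f f\<^sup>*\<close>, which is that of \<open>f\<^sup>*\<close>
  because \<open>\<langle>f f\<^sup>* z, z\<rangle>\<close> is the square of the norm of \<open>f\<^sup>* z\<close>.\<close>

lemma adjoint_pinv_gram:
  assumes y: "y \<in> vecs W"
  shows "adj (pinv_on W W (f \<circ> adj) (f (adj y))) = adj y"
proof -
  interpret G: fin_ip_map W W "f \<circ> adj" by (rule gram_map)
  interpret A: fin_ip_map W V adj
    by unfold_locales (rule linear_adjoint)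
  define p where "p = pinv_on W W (f \<circ> adj) (f (adj y))"
  have p: "p \<in> vecs W"
    unfolding p_def using y by (intro G.pinv_in) auto
  have "f (adj p) = f (adj y)"
    unfolding p_def using G.f_pinv_f[OF y] by simp
  then have "f (adj (p - y)) = 0"
    using p y by (simp add: A.f_diff f_diff)
  then have "ip V (adj (p - y)) (adj (p - y)) = 0"
    using p y adjoint_ip[of "p - y" "adj (p - y)"] by (simp add: W.ip_zero_left)
  then have "adj (p - y) = 0"
    using p y V.ip_eq_zero_iff by auto
  then show ?thesis
    using p y by (simp add: A.f_diff p_def)
qed

text \<open>If \<open>\<alpha>\<close> has the same image as some \<open>f\<^sup>* y\<close>, the quadratic form below is the energy of that
  \<open>f\<^sup>* y\<close>, since \<open>\<alpha> - f\<^sup>* y\<close> lies in the kernel of \<open>f\<close>, which is orthogonal to the range of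
  \<open>f\<^sup>*\<close>.\<close>

lemma pinv_gram_energy:
  assumes \<alpha>: "\<alpha> \<in> vecs V" and y: "y \<in> vecs W" and eq: "f \<alpha> = f (adj y)"
  shows "ip V (adj (pinv_on W W (f \<circ> adj) (f \<alpha>))) \<alpha> = ip V (adj y) (adj y)"
proof -
  have "ip V (adj (pinv_on W W (f \<circ> adj) (f \<alpha>))) \<alpha> = ip V \<alpha> (adj y)"
    using \<alpha> y by (simp add: eq adjoint_pinv_gram adjoint_in V.ip_commute)
  also have "\<dots> = ip W (f (adj y)) y"
    using \<alpha> y by (simp flip: adjoint_ip eq)
  also have "\<dots> = ip V (adj y) (adj y)"
    using y by (simp add: adjoint_ip adjoint_in)
  finally show ?thesis .
qed

end

section \<open>The chain spaces of a simplicial network\<close>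

lemma finite_simplices:
  assumes "simplicial_network n d X w"
  shows "finite (simplices X p)"
  by (rule finite_subset[of _ "Pow {1..n}"])
    (use assms in \<open>auto simp: simplicial_network_def simplices_def\<close>)

lemma lookup_scaleR: "Poly_Mapping.lookup (r *\<^sub>R \<alpha>) \<tau> = r * Poly_Mapping.lookup (\<alpha> :: chain) \<tau>"
proof -
  have "finite {\<rho>. r *\<^sub>R Poly_Mapping.lookup \<alpha> \<rho> \<noteq> 0}"
    by (rule finite_subset[OF _ finite_lookup[of \<alpha>]]) auto
  then show ?thesis
    by (simp add: scaleR_poly_mapping_def)
qed

lemma chain_space_iff:
  "\<alpha> \<in> vecs (chain_space d X w p) \<longleftrightarrow> (\<forall>\<tau>. \<tau> \<notin> simplices X p \<longrightarrow> Poly_Mapping.lookup \<alpha> \<tau> = 0)"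
  by (auto simp: chain_space_def in_keys_iff)

lemma subspace_chain_space: "subspace (vecs (chain_space d X w p))"
  by (auto simp: real_vector.subspace_def chain_space_iff lookup_add lookup_scaleR)

lemma chain_expansion:
  assumes "finite A" "Poly_Mapping.keys \<alpha> \<subseteq> A"
  shows "(\<Sum>\<tau>\<in>A. Poly_Mapping.lookup \<alpha> \<tau> *\<^sub>R simplex_chain \<tau>) = \<alpha>"
proof (rule poly_mapping_eqI)
  fix \<rho>
  have "Poly_Mapping.lookup (\<Sum>\<tau>\<in>A. Poly_Mapping.lookup \<alpha> \<tau> *\<^sub>R simplex_chain \<tau>) \<rho> =
      (\<Sum>\<tau>\<in>A. if \<tau> = \<rho> then Poly_Mapping.lookup \<alpha> \<tau> else 0)"
    by (auto simp: lookup_sum lookup_scaleR lookup_single intro!: sum.cong)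
  also have "\<dots> = Poly_Mapping.lookup \<alpha> \<rho>"
    using assms by (auto simp: in_keys_iff)
  finally show "Poly_Mapping.lookup (\<Sum>\<tau>\<in>A. Poly_Mapping.lookup \<alpha> \<tau> *\<^sub>R simplex_chain \<tau>) \<rho> =
      Poly_Mapping.lookup \<alpha> \<rho>" .
qed

lemma fin_ip_space_chain_space:
  assumes net: "simplicial_network n d X w"
  shows "fin_ip_space (chain_space d X w p)"
proof
  let ?S = "simplices X p"
  show "subspace (vecs (chain_space d X w p))"
    by (rule subspace_chain_space)
  show "\<exists>B. finite B \<and> vecs (chain_space d X w p) \<subseteq> span B"
  proof (intro exI conjI subsetI)
    show "finite (simplex_chain ` ?S)"
      using net by (simp add: finite_simplices)
    fix \<alpha> assume "\<alpha> \<in> vecs (chain_space d X w p)"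
    then have "\<alpha> = (\<Sum>\<tau>\<in>?S. Poly_Mapping.lookup \<alpha> \<tau> *\<^sub>R simplex_chain \<tau>)"
      using net by (simp add: chain_expansion finite_simplices chain_space_def)
    also have "\<dots> \<in> span (simplex_chain ` ?S)"
      by (intro span_sum span_scale span_base) auto
    finally show "\<alpha> \<in> span (simplex_chain ` ?S)" .
  qed
next
  fix x assume x: "x \<in> vecs (chain_space d X w p)" "x \<noteq> 0"
  let ?m = "\<lambda>\<tau>. if p = d then w \<tau> else 1"
  have m: "?m \<tau> > 0" if "\<tau> \<in> simplices X p" for \<tau>
    using net that by (auto simp: simplicial_network_def simplices_def)
  obtain \<tau> where \<tau>: "Poly_Mapping.lookup x \<tau> \<noteq> 0"
    using x(2) poly_mapping_eqI[of x 0] by auto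
  then have "\<tau> \<in> simplices X p"
    using x(1) chain_space_iff by blast
  moreover have "Poly_Mapping.lookup x \<tau> * Poly_Mapping.lookup x \<tau> / ?m \<tau> > 0"
    using m[OF \<open>\<tau> \<in> simplices X p\<close>] \<tau> by (simp add: divide_pos_pos flip: power2_eq_square)
  moreover have "Poly_Mapping.lookup x \<rho> * Poly_Mapping.lookup x \<rho> / ?m \<rho> \<ge> 0"
    if "\<rho> \<in> simplices X p" for \<rho>
    using m[OF that] by (intro divide_nonneg_pos) auto
  ultimately have "0 < (\<Sum>\<tau>\<in>simplices X p. Poly_Mapping.lookup x \<tau> * Poly_Mapping.lookup x \<tau> / ?m \<tau>)"
    by (intro sum_pos2[OF finite_simplices[OF net]])
  then show "0 < ip (chain_space d X w p) x x"
    by (simp add: chain_space_def)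
qed (simp_all add: chain_space_def lookup_add lookup_scaleR algebra_simps add_divide_distrib
    sum.distrib sum_distrib_left)

lemma boundary_eq_sum:
  assumes "finite A" "Poly_Mapping.keys \<alpha> \<subseteq> A"
  shows "boundary \<alpha> = (\<Sum>\<tau>\<in>A. Poly_Mapping.lookup \<alpha> \<tau> *\<^sub>R simplex_boundary \<tau>)"
  unfolding boundary_def by (rule sum.mono_neutral_left) (use assms in \<open>auto simp: in_keys_iff\<close>)

lemma boundary_simplex_chain: "boundary (simplex_chain \<tau>) = simplex_boundary \<tau>"
  by (simp add: boundary_def)

lemma simplex_boundary_in:
  assumes net: "simplicial_network n d X w" and "p \<ge> 1" and \<tau>: "\<tau> \<in> simplices X p"
  shows "simplex_boundary \<tau> \<in> vecs (chain_space d X w (p - 1))"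
  unfolding simplex_boundary_def
proof (rule subspace_sum[OF subspace_chain_space], rule subspace_scale[OF subspace_chain_space])
  fix v assume v: "v \<in> \<tau>"
  have card: "card (\<tau> - {v}) = p"
    using \<tau> v by (simp add: simplices_def)
  then have nonempty: "\<tau> - {v} \<noteq> {}"
    using \<open>p \<ge> 1\<close> by fastforce
  have "\<tau> \<in> X"
    using \<tau> by (simp add: simplices_def)
  then have "\<rho> \<in> X" if "\<rho> \<subseteq> \<tau>" "\<rho> \<noteq> {}" for \<rho>
    using net that unfolding simplicial_network_def by blast
  from this[OF Diff_subset nonempty] have "\<tau> - {v} \<in> X" .
  then have "\<tau> - {v} \<in> simplices X (p - 1)"
    unfolding simplices_def using card \<open>p \<ge> 1\<close> by (intro CollectI conjI) simp_all
  then show "simplex_chain (\<tau> - {v}) \<in> vecs (chain_space d X w (p - 1))"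
    by (simp add: chain_space_def)
qed

lemma linear_boundary:
  assumes net: "simplicial_network n d X w" and "p \<ge> 1"
  shows "linear_between (vecs (chain_space d X w p)) (vecs (chain_space d X w (p - 1))) boundary"
proof -
  let ?C = "vecs (chain_space d X w p)"
  have b: "boundary \<alpha> = (\<Sum>\<tau>\<in>simplices X p. Poly_Mapping.lookup \<alpha> \<tau> *\<^sub>R simplex_boundary \<tau>)"
    if "\<alpha> \<in> ?C" for \<alpha>
    using that net by (intro boundary_eq_sum) (auto simp: chain_space_def finite_simplices)
  have "boundary \<alpha> \<in> vecs (chain_space d X w (p - 1))" if "\<alpha> \<in> ?C" for \<alpha>
    unfolding b[OF that]
    using simplex_boundary_in[OF assms]
    by (intro subspace_sum[OF subspace_chain_space] subspace_scale[OF subspace_chain_space])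
  moreover have "x + y \<in> ?C" "r *\<^sub>R x \<in> ?C" if "x \<in> ?C" "y \<in> ?C" for x y r
    using that subspace_chain_space by (simp_all add: subspace_add subspace_scale)
  ultimately show ?thesis
    by (auto simp: linear_between_def b lookup_add lookup_scaleR scaleR_add_left sum.distrib
        scaleR_sum_right)
qed

section \<open>Effective resistance as energy\<close>

text \<open>This is \<open>pinv_gram_energy\<close> for \<open>f = \<partial>\<^sub>d\<close>: a chain with the boundary of a gradient
  \<open>\<partial>\<^sup>* y\<close> has as its effective resistance the energy of that gradient.\<close>

lemma eff_resistance_energy:
  assumes net: "simplicial_network n d X w" and "d \<ge> 1"
    and "\<alpha> \<in> vecs (chain_space d X w d)" and "y \<in> vecs (chain_space d X w (d - 1))"
    and "boundary \<alpha> = boundary (boundary_adjoint d X w y)"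
  shows "eff_resistance d X w \<alpha> \<alpha> =
    ip (chain_space d X w d) (boundary_adjoint d X w y) (boundary_adjoint d X w y)"
proof -
  interpret V: fin_ip_space "chain_space d X w d"
    by (rule fin_ip_space_chain_space[OF net])
  interpret W: fin_ip_space "chain_space d X w (d - 1)"
    by (rule fin_ip_space_chain_space[OF net])
  interpret fin_ip_map "chain_space d X w d" "chain_space d X w (d - 1)" boundary
    by unfold_locales (rule linear_boundary[OF net \<open>d \<ge> 1\<close>])
  show ?thesis
    using pinv_gram_energy assms
    by (simp add: eff_resistance_def up_laplacian_def boundary_adjoint_def)
qed

theorem proposition6p14:
  fixes n d :: nat and X :: "nat set set" and w :: "nat set \<Rightarrow> real" and \<sigma> :: "nat set"
    and i_\<sigma> v_\<sigma> :: real and I :: chain and V \<phi> :: "chain \<Rightarrow> real"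
  assumes "d \<ge> 1"
    and "simplicial_network n d X w"
    and "current_generator n d X w \<sigma>"
    and "\<sigma> \<in> simplices X d"
    and "i_\<sigma> \<noteq> 0"
    and "is_current d X w \<sigma> i_\<sigma> I"
    and "V = flat_on (chain_space d X w d) I"
    and "ext_voltage d X w V v_\<sigma> (I, i_\<sigma>) = 0"
    and "\<phi> \<in> dual_on (chain_space d X w (d - 1))"
    and "coboundary d X w (d - 1) \<phi> = V"
  shows "eff_resistance d X w (simplex_chain \<sigma>) (simplex_chain \<sigma>) = - v_\<sigma> / i_\<sigma>"
proof -
  let ?C = "chain_space d X w d" and ?D = "chain_space d X w (d - 1)"
  note net = \<open>simplicial_network n d X w\<close>
  interpret C: fin_ip_space ?C
    by (rule fin_ip_space_chain_space[OF net])
  interpret D: fin_ip_space ?D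
    by (rule fin_ip_space_chain_space[OF net])
  interpret fin_ip_map ?C ?D boundary
    by unfold_locales (rule linear_boundary[OF net \<open>d \<ge> 1\<close>])
  interpret A: fin_ip_map ?D ?C adj
    by unfold_locales (rule linear_adjoint)
  have I: "I \<in> vecs ?C" and kirchhoff: "boundary I + i_\<sigma> *\<^sub>R simplex_boundary \<sigma> = 0"
    using \<open>is_current d X w \<sigma> i_\<sigma> I\<close> by (auto simp: is_current_def kernel_on_def ext_boundary_def)
  obtain y where y: "y \<in> vecs ?D" "\<And>a. a \<in> vecs ?D \<Longrightarrow> \<phi> a = ip ?D a y"
    using D.riesz[of \<phi>] \<open>\<phi> \<in> dual_on ?D\<close> by (auto simp: dual_on_def)
  (* Ohm's law: the current is the gradient of the chain that represents the potential *)
  have adj_y: "adj y = I"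
  proof (rule adjoint_unique)
    fix a assume a: "a \<in> vecs ?C"
    have "ip ?D (boundary a) y = coboundary d X w (d - 1) \<phi> a"
      using a y(2)[OF f_in[OF a]] \<open>d \<ge> 1\<close> by (simp add: coboundary_def)
    also have "\<dots> = ip ?C I a"
      using a \<open>coboundary d X w (d - 1) \<phi> = V\<close> \<open>V = flat_on ?C I\<close> by (simp add: flat_on_def)
    finally show "ip ?D (boundary a) y = ip ?C a I"
      using a I by (simp add: C.ip_commute)
  qed (use y I in auto)
  (* Kirchhoff's law gives boundary I = - i_\<sigma> * boundary \<sigma>, so scaling the potential by
     - 1 / i_\<sigma> makes the boundary of the current equal to that of \<sigma> *)
  define u where "u = (- 1 / i_\<sigma>) *\<^sub>R y"
  have u: "u \<in> vecs ?D" "adj u = (- 1 / i_\<sigma>) *\<^sub>R I"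
    unfolding u_def adj_y[symmetric] by (rule D.closed(4)[OF y(1)], rule A.f_scaleR[OF y(1)])
  have "boundary I = - (i_\<sigma> *\<^sub>R simplex_boundary \<sigma>)"
    using kirchhoff by (simp add: eq_neg_iff_add_eq_0)
  then have "boundary (simplex_chain \<sigma>) = boundary (adj u)"
    using \<open>i_\<sigma> \<noteq> 0\<close> by (simp only: u(2) f_scaleR[OF I] boundary_simplex_chain) simp
  moreover have "simplex_chain \<sigma> \<in> vecs ?C"
    using \<open>\<sigma> \<in> simplices X d\<close> by (simp add: chain_space_def)
  ultimately have "eff_resistance d X w (simplex_chain \<sigma>) (simplex_chain \<sigma>) = ip ?C (adj u) (adj u)"
    using eff_resistance_energy[OF net \<open>d \<ge> 1\<close> _ u(1)] by (simp add: boundary_adjoint_def)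
  also have "\<dots> = ip ?C I I / i_\<sigma>\<^sup>2"
    unfolding u(2) C.ip_scaleR_left[OF I C.closed(4)[OF I]] C.ip_scaleR_right[OF I I]
    by (simp add: power2_eq_square)
  also have "ip ?C I I = - v_\<sigma> * i_\<sigma>"
    using \<open>ext_voltage d X w V v_\<sigma> (I, i_\<sigma>) = 0\<close> I \<open>V = flat_on ?C I\<close>
    by (simp add: ext_voltage_def ext_chains_def flat_on_def)
  finally show ?thesis
    using \<open>i_\<sigma> \<noteq> 0\<close> by (simp add: power2_eq_square)
qed

end
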